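(* Let $(a_k)_{k\ge 0}$ be i.i.d. positive random variables and let $\alpha_k=\ln a_k$. Assume the distribution of $\alpha_k$ is non-lattice and has finite third absolute moment, and let $\mu_\alpha=\mathbb{E}[\alpha_k]$. Let $x_0=1$ and $x_{k+1}=a_kx_k$ for $k=0,1,2,\dots$, so that $x_K=\prod_{k=0}^{K-1}a_k$. Then \[ \lim_{K\to\infty}\operatorname{median}(x_K)=0\quad\iff\quad \mu_\alpha<0. \]
   Context: A distribution of a real random variable $\alpha$ is a lattice distribution if there exist $b\in\mathbb{R}$ and $h>0$ such that $\mathbb{P}\{\alpha\in b+h\mathbb{Z}\}=1$; non-lattice means it is not lattice. $\operatorname{median}(Y)$ denotes the median of the distribution of $Y$. The initial state is normalised to $x_0=1$ (a standing assumption of the paper). *)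

theory Defs
  imports "HOL-Probability.Probability"
begin

definition lattice_rv :: "'a measure \<Rightarrow> ('a \<Rightarrow> real) \<Rightarrow> bool" where
  "lattice_rv M Y \<longleftrightarrow>
     (\<exists>b h. h > 0 \<and> measure M {x \<in> space M. \<exists>z::int. Y x = b + h * of_int z} = 1)"

text \<open>Median of the distribution of Y (lower median convention:
  the smallest m with P(Y <= m) >= 1/2).\<close>
definition median_rv :: "'a measure \<Rightarrow> ('a \<Rightarrow> real) \<Rightarrow> real" where
  "median_rv M Y = Inf {m. measure M {x \<in> space M. Y x \<le> m} \<ge> 1/2}"

end

theory Submission
  imports Defs
begin

text \<open>
  Put \<open>S\<^sub>n = \<Sum>k<n. (\<alpha>\<^sub>k - \<mu>)\<close>. Everything follows from one Berry-Esseen type fact: for a centred i.i.d. sum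
  with positive variance and finite third moment there is a constant \<open>c\<close> with
  \<open>P(S\<^sub>n \<le> - c) < 1/2\<close> for all large \<open>n\<close>. If \<open>\<mu> \<ge> 0\<close> it bounds the median of \<open>x\<^sub>n\<close> below by \<open>exp (- c)\<close>;
  applied to \<open>- S\<^sub>n\<close> it bounds the median above by \<open>exp (c + n \<mu>)\<close>, which tends to 0 if \<open>\<mu> < 0\<close>.

  For the fact itself, the indicator of \<open>x \<le> 0\<close> is majorised by
  \<open>1/2 - H x / pi + 40 (F x + F (x + pi))\<close>, where \<open>H\<close> (a smoothed sign) and \<open>F\<close> (the Fejer kernel) have
  Fourier transforms supported in \<open>[-1, 1]\<close>. Hence only the characteristic function \<open>\<phi>\<^sup>n\<close> near 0 matters.
  Rescaling so that \<open>\<phi> s = 1 - v s\<^sup>2 / 2 + O(s\<^sup>3)\<close> is a good approximation on \<open>[0, 1]\<close>, all error terms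
  contribute \<open>O(1 / sqrt n)\<close> with a constant independent of \<open>c\<close>, while the shift by \<open>c\<close> gains a
  positive multiple of \<open>c / sqrt n\<close>; so a large \<open>c\<close> wins.
\<close>

subsection \<open>Band-limited kernels\<close>

text \<open>Frequencies carry the uniform law on the open unit interval. As a probability space it
  makes bounded functions integrable and can be paired with a distribution for Fubini; leaving out 0
  keeps quotients by \<open>s\<close> genuine.\<close>

definition unit_lebesgue :: "real measure" where
  "unit_lebesgue = restrict_space lborel {0<..<1}"

lemma space_unit_lebesgue [simp]: "space unit_lebesgue = {0<..<1}"
  by (simp add: unit_lebesgue_def space_restrict_space)

lemma borel_measurable_unit_lebesgue:
  "f \<in> borel_measurable borel \<Longrightarrow> f \<in> borel_measurable unit_lebesgue"
  unfolding unit_lebesgue_def by (intro measurable_restrict_space1) simp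

lemma measurable_ident_unit_lebesgue [measurable]: "(\<lambda>s. s) \<in> borel_measurable unit_lebesgue"
  by (rule borel_measurable_unit_lebesgue) simp

interpretation unit_lebesgue: prob_space unit_lebesgue
  by (rule prob_spaceI) (simp add: unit_lebesgue_def emeasure_restrict_space space_restrict_space)

lemma integral_unit_lebesgue:
  fixes f :: "real \<Rightarrow> real"
  shows "(\<integral>s. f s \<partial>unit_lebesgue) = (LBINT s=0..1. f s)"
  by (simp add: unit_lebesgue_def integral_restrict_space interval_lebesgue_integral_def
      set_lebesgue_integral_def zero_ereal_def one_ereal_def)

lemma integral_unit_lebesgue_FTC:
  fixes f F :: "real \<Rightarrow> real"
  assumes "continuous_on {0..1} f"
    and "\<And>s. 0 \<le> s \<Longrightarrow> s \<le> 1 \<Longrightarrow> (F has_real_derivative f s) (at s)"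
  shows "(\<integral>s. f s \<partial>unit_lebesgue) = F 1 - F 0"
  unfolding integral_unit_lebesgue zero_ereal_def one_ereal_def using assms
  by (intro interval_integral_FTC_finite)
     (auto simp: has_real_derivative_iff_has_vector_derivative intro: has_vector_derivative_at_within)

lemma AE_unit_lebesgue: "(\<And>s. 0 < s \<Longrightarrow> s < 1 \<Longrightarrow> P s) \<Longrightarrow> AE s in unit_lebesgue. P s"
  by (rule AE_I2) auto

text \<open>A truncated Dirichlet integral: the sine integral of 1/s over the whole half-line would
  be pi/2 times the sign of x. The cutoff \<open>1 - s\<^sup>2\<close> vanishes at s = 1, which
  improves the error at infinity from order 1/x to order 1/x^2.\<close>

definition sign_kernel :: "real \<Rightarrow> real" where
  "sign_kernel x = (\<integral>s. (1 - s\<^sup>2) * (sin (s * x) / s) \<partial>unit_lebesgue)"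

text \<open>Half the Fourier transform of the triangular weight 1 - |s| on [-1, 1].\<close>

definition fejer_kernel :: "real \<Rightarrow> real" where
  "fejer_kernel x = (\<integral>s. (1 - s) * cos (s * x) \<partial>unit_lebesgue)"

lemma sign_kernel_eq:
  assumes "x > 0"
  shows "sign_kernel x = Si x + cos x / x - sin x / x\<^sup>2"
proof -
  let ?F = "\<lambda>s. Si (s * x) + s * cos (s * x) / x - sin (s * x) / x\<^sup>2"
  \<comment> \<open>\<open>x * sinc (s * x)\<close> extends \<open>sin (s * x) / s\<close>
    continuously to s = 0, as the fundamental theorem on the closed interval requires.\<close>
  have "sign_kernel x = (\<integral>s. (1 - s\<^sup>2) * (x * sinc (s * x)) \<partial>unit_lebesgue)"
    unfolding sign_kernel_def using assms by (intro Bochner_Integration.integral_cong) auto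
  also have "\<dots> = ?F 1 - ?F 0"
  proof (rule integral_unit_lebesgue_FTC)
    show "continuous_on {0..1} (\<lambda>s. (1 - s\<^sup>2) * (x * sinc (s * x)))"
      by (intro continuous_intros continuous_on_sinc)
    fix s :: real
    have "(?F has_real_derivative sinc (s * x) * x + (cos (s * x) / x - s * sin (s * x))
        - cos (s * x) / x) (at s)"
      using assms
      by (auto intro!: derivative_eq_intros DERIV_chain2[OF DERIV_Si] simp: field_simps power2_eq_square)
    moreover have "sinc (s * x) * x + (cos (s * x) / x - s * sin (s * x)) - cos (s * x) / x
        = (1 - s\<^sup>2) * (x * sinc (s * x))"
      using assms by (auto simp: field_simps power2_eq_square)
    ultimately show "(?F has_real_derivative (1 - s\<^sup>2) * (x * sinc (s * x))) (at s)"
      by simp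
  qed
  also have "\<dots> = Si x + cos x / x - sin x / x\<^sup>2"
    by (simp add: Si_alt_def zero_ereal_def)
  finally show ?thesis .
qed

lemma fejer_kernel_eq:
  assumes "x \<noteq> 0"
  shows "fejer_kernel x = (1 - cos x) / x\<^sup>2"
proof -
  let ?F = "\<lambda>s. (1 - s) * sin (s * x) / x - cos (s * x) / x\<^sup>2"
  have "fejer_kernel x = ?F 1 - ?F 0"
    unfolding fejer_kernel_def
  proof (rule integral_unit_lebesgue_FTC)
    show "continuous_on {0..1} (\<lambda>s. (1 - s) * cos (s * x))"
      by (intro continuous_intros)
    show "(?F has_real_derivative (1 - s) * cos (s * x)) (at s)" for s
      using assms by (auto intro!: derivative_eq_intros simp: field_simps power2_eq_square)
  qed
  then show ?thesis by (simp add: diff_divide_distrib)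
qed

lemma fejer_kernel_0: "fejer_kernel 0 = 1 / 2"
proof -
  have "fejer_kernel 0 = (\<lambda>s. s - s\<^sup>2 / 2) 1 - (\<lambda>s. s - s\<^sup>2 / 2 :: real) 0"
    unfolding fejer_kernel_def
    by (rule integral_unit_lebesgue_FTC) (auto intro!: derivative_eq_intros continuous_intros)
  then show ?thesis by simp
qed

section \<open>Symmetry, size and asymptotics of the smoothed sign\<close>

lemma sign_kernel_minus: "sign_kernel (- x) = - sign_kernel x"
  by (simp add: sign_kernel_def)

lemma sign_kernel_0: "sign_kernel 0 = 0"
  by (simp add: sign_kernel_def)

lemma abs_sin_mult_div_le:
  fixes s x :: real
  assumes "s > 0"
  shows "\<bar>sin (s * x) / s\<bar> \<le> \<bar>x\<bar>"
  using abs_sin_x_le_abs_x[of "s * x"] assms by (simp add: abs_mult divide_le_eq mult.commute)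

lemma abs_sign_integrand_le:
  fixes s x :: real
  assumes "0 < s" "s < 1"
  shows "\<bar>(1 - s\<^sup>2) * (sin (s * x) / s)\<bar> \<le> \<bar>x\<bar>"
proof -
  have "\<bar>1 - s\<^sup>2\<bar> \<le> 1" using assms by (simp add: abs_le_iff power_le_one)
  then have "\<bar>1 - s\<^sup>2\<bar> * \<bar>sin (s * x) / s\<bar> \<le> 1 * \<bar>x\<bar>"
    using assms by (intro mult_mono abs_sin_mult_div_le) auto
  then show ?thesis by (simp only: abs_mult mult_1)
qed

lemma integrable_sign_integrand:
  "integrable unit_lebesgue (\<lambda>s. (1 - s\<^sup>2) * (sin (s * x) / s))"
  by (rule unit_lebesgue.integrable_const_bound[of _ "\<bar>x\<bar>"])
     (use abs_sign_integrand_le in \<open>auto intro!: AE_unit_lebesgue simp del: times_divide_eq_right\<close>)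

lemma abs_sign_kernel_le: "\<bar>sign_kernel x\<bar> \<le> \<bar>x\<bar>"
proof -
  have "\<bar>sign_kernel x\<bar> \<le> (\<integral>s. \<bar>(1 - s\<^sup>2) * (sin (s * x) / s)\<bar> \<partial>unit_lebesgue)"
    unfolding sign_kernel_def by (rule integral_abs_bound)
  also have "\<dots> \<le> (\<integral>s. \<bar>x\<bar> \<partial>unit_lebesgue)"
    by (rule integral_mono)
       (use abs_sign_integrand_le integrable_sign_integrand
         in \<open>auto simp del: times_divide_eq_right intro!: integrable_abs\<close>)
  finally show ?thesis using unit_lebesgue.prob_space by (simp del: space_unit_lebesgue)
qed

text \<open>Adding \<open>2 sin x / x\<^sup>2\<close> removes the leading oscillation of the derivative, which becomes
  \<open>- 2 sin x / x\<^sup>3\<close> and is dominated by the derivative of \<open>1 / x\<^sup>2\<close>.\<close>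
lemma sign_kernel_asymp:
  assumes "x > 0"
  shows "\<bar>sign_kernel x - pi / 2\<bar> \<le> 3 / x\<^sup>2"
proof -
  define G where "G = (\<lambda>c y. Si y + cos y / y + sin y / y\<^sup>2 + c / y\<^sup>2)"
  have dG: "(G c has_real_derivative - 2 * (sin y + c) / y ^ 3) (at y)" if "y > 0" for c y
    unfolding G_def using that
    by (auto intro!: derivative_eq_intros DERIV_Si simp: field_simps power2_eq_square power3_eq_cube)
  have inv0: "((\<lambda>y::real. inverse y) \<longlongrightarrow> 0) at_top"
    by (rule tendsto_inverse_0_at_top) (rule filterlim_ident)
  have inv2: "((\<lambda>y::real. inverse y * inverse y) \<longlongrightarrow> 0) at_top"
    using tendsto_mult[OF inv0 inv0] by simp
  have c0: "((\<lambda>y::real. cos y / y) \<longlongrightarrow> 0) at_top"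
    by (rule Lim_null_comparison[OF _ inv0])
       (auto intro!: eventually_mono[OF eventually_gt_at_top[of 0]] simp: divide_simps)
  have s0: "((\<lambda>y::real. sin y / y\<^sup>2) \<longlongrightarrow> 0) at_top"
    by (rule Lim_null_comparison[OF _ inv2])
       (auto intro!: eventually_mono[OF eventually_gt_at_top[of 0]] simp: divide_simps power2_eq_square)
  have k0: "((\<lambda>y::real. c / y\<^sup>2) \<longlongrightarrow> 0) at_top" for c
    using tendsto_mult[OF tendsto_const[of c] inv2] by (simp add: power2_eq_square divide_inverse)
  have limG: "(G c \<longlongrightarrow> pi / 2) at_top" for c
    unfolding G_def using tendsto_add[OF tendsto_add[OF tendsto_add[OF Si_at_top c0] s0] k0] by simp
  \<comment> \<open>Both \<open>G 1\<close> and \<open>G (- 1)\<close> tend to pi/2, the first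
    decreasing and the second increasing, so their values at x enclose pi/2.\<close>
  have "G 1 y \<le> G 1 x" if "x \<le> y" for y
  proof (rule DERIV_nonpos_imp_nonincreasing[OF that])
    fix z assume "x \<le> z"
    moreover have "0 \<le> sin z + 1" using sin_ge_minus_one[of z] by linarith
    ultimately show "\<exists>d. (G 1 has_real_derivative d) (at z) \<and> d \<le> 0"
      using assms by (intro exI[of _ "- 2 * (sin z + 1) / z ^ 3"] conjI dG divide_nonpos_pos) auto
  qed
  then have lower: "pi / 2 \<le> G 1 x"
    by (intro tendsto_upperbound[OF limG]) (auto intro: eventually_mono[OF eventually_ge_at_top[of x]])
  have "G (- 1) x \<le> G (- 1) y" if "x \<le> y" for y
  proof (rule DERIV_nonneg_imp_nondecreasing[OF that])
    fix z assume "x \<le> z"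
    then show "\<exists>d. (G (- 1) has_real_derivative d) (at z) \<and> 0 \<le> d"
      using assms by (intro exI[of _ "- 2 * (sin z + - 1) / z ^ 3"] conjI dG divide_nonneg_pos) auto
  qed
  then have upper: "G (- 1) x \<le> pi / 2"
    by (intro tendsto_lowerbound[OF limG]) (auto intro: eventually_mono[OF eventually_ge_at_top[of x]])
  \<comment> \<open>The constant 3 is 2 from the added oscillating term plus 1 from c / x^2 with c =
    1 or c = -1.\<close>
  have "\<bar>sin x / x\<^sup>2\<bar> \<le> 1 / x\<^sup>2"
    by (simp add: divide_right_mono)
  moreover have "3 / x\<^sup>2 = 3 * (1 / x\<^sup>2)" "- 1 / x\<^sup>2 = - (1 / x\<^sup>2)" by simp_all
  ultimately show ?thesis
    using lower upper unfolding sign_kernel_eq[OF assms] G_def abs_le_iff by linarith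
qed

text \<open>A single Fejer kernel has zeros. Shifting by pi turns the numerator 1 - cos x into 1 +
  cos x; the two add up to 2, and both denominators are at most (|x| + pi)^2. The points 0 and -pi
  are separate because the closed form fails there.\<close>

lemma fejer_kernel_sum_ge: "2 / (\<bar>x\<bar> + pi)\<^sup>2 \<le> fejer_kernel x + fejer_kernel (x + pi)"
proof -
  have nz: "\<bar>x\<bar> + pi \<noteq> 0" using pi_gt_zero by linarith
  consider "x = 0" | "x = - pi" | "x \<noteq> 0" "x + pi \<noteq> 0" by linarith
  then show ?thesis
  proof cases
    case 1
    then show ?thesis by (simp add: fejer_kernel_0 fejer_kernel_eq)
  next
    case 2
    have "2 / (pi + pi)\<^sup>2 \<le> 2 / pi\<^sup>2"
      by (intro divide_left_mono power_mono) auto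
    then show ?thesis using 2 by (simp add: fejer_kernel_0 fejer_kernel_eq)
  next
    case 3
    have main1: "(1 - cos x) / (\<bar>x\<bar> + pi)\<^sup>2 \<le> (1 - cos x) / x\<^sup>2"
      using 3 nz by (intro divide_left_mono abs_le_square_iff[THEN iffD1]) (auto intro!: mult_pos_pos add_nonneg_pos)
    have pos: "0 \<le> 1 + cos x" "\<bar>x + pi\<bar> \<le> \<bar>x\<bar> + pi"
      using cos_ge_minus_one[of x] pi_gt_zero by linarith+
    have "(1 + cos x) / (\<bar>x\<bar> + pi)\<^sup>2 \<le> (1 + cos x) / (x + pi)\<^sup>2"
      using 3 nz cos_ge_minus_one[of x] pos
      by (intro divide_left_mono abs_le_square_iff[THEN iffD1]) (auto intro!: mult_pos_pos add_nonneg_pos)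
    then show ?thesis
      using 3 main1 by (simp add: fejer_kernel_eq add_divide_distrib diff_divide_distrib)
  qed
qed

text \<open>By oddness only |x| matters. Since pi < 4, |x| + pi is at most 5 max(1, |x|), so 40
  \<open>q\<close> is at least 80/25 = 3.2 for |x| <= 1 and 3.2 / x^2 beyond. The error is at most 1
  + pi/2 < 3.2 in the first range and 3 / x^2 in the second.\<close>

lemma sign_kernel_error:
  "\<bar>sign_kernel x - pi / 2 * sgn x\<bar> \<le> 40 * (fejer_kernel x + fejer_kernel (x + pi))"
proof -
  have nz: "\<bar>x\<bar> + pi \<noteq> 0" using pi_gt_zero by linarith
  define q where "q = 2 / (\<bar>x\<bar> + pi)\<^sup>2"
  have pos: "sign_kernel y - pi / 2 \<le> 40 * q \<and> pi / 2 - sign_kernel y \<le> 40 * q" 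
    if y: "y > 0" "\<bar>x\<bar> = y" for y
  proof (cases "y \<le> 1")
    case True
    have "(\<bar>x\<bar> + pi)\<^sup>2 \<le> 5\<^sup>2"
      using True y pi_less_4 pi_gt_zero by (intro power_mono) linarith+
    then have "2 / 25 \<le> q"
      unfolding q_def using nz by (intro divide_left_mono) (auto intro!: add_nonneg_pos)
    then show ?thesis using abs_sign_kernel_le[of y] True y pi_less_4 pi_gt3 by (simp add: abs_le_iff)
  next
    case False
    have "(\<bar>x\<bar> + pi)\<^sup>2 \<le> (5 * y)\<^sup>2"
      using False y pi_less_4 pi_gt_zero by (intro power_mono) linarith+
    then have "2 / (25 * y\<^sup>2) \<le> q"
      unfolding q_def using y nz
      by (intro divide_left_mono) (auto intro!: mult_pos_pos add_nonneg_pos simp: power_mult_distrib)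
    moreover have "3 / y\<^sup>2 \<le> 40 * (2 / (25 * y\<^sup>2))"
      using y by (simp add: divide_simps)
    ultimately show ?thesis using sign_kernel_asymp[of y] y by (simp add: abs_le_iff)
  qed
  have "\<bar>sign_kernel x - pi / 2 * sgn x\<bar> \<le> 40 * q"
  proof (cases x "0::real" rule: linorder_cases)
    case less
    then show ?thesis using pos[of "- x"] by (simp add: sign_kernel_minus abs_le_iff)
  next
    case equal
    then show ?thesis by (simp add: sign_kernel_0 q_def)
  next
    case greater
    then show ?thesis using pos[of x] by (simp add: abs_le_iff)
  qed
  also have "\<dots> \<le> 40 * (fejer_kernel x + fejer_kernel (x + pi))"
    using fejer_kernel_sum_ge[of x] unfolding q_def by (intro mult_left_mono) auto
  finally show ?thesis .
qed

text \<open>Off 0 the indicator is 1/2 - sgn x / 2, and the error of the smoothed sign, divided by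
  pi > 1, is covered by the Fejer terms. At 0, where the sign formula gives only 1/2, the Fejer
  terms contribute at least 20.\<close>

lemma indicator_le_kernels:
  "indicator {..0} x \<le> 1 / 2 - sign_kernel x / pi + 40 * (fejer_kernel x + fejer_kernel (x + pi))"
proof (cases "x = 0")
  case True
  then show ?thesis by (simp add: sign_kernel_0 fejer_kernel_0 fejer_kernel_eq add_increasing2)
next
  case False
  define E where "E = 40 * (fejer_kernel x + fejer_kernel (x + pi))"
  have E: "\<bar>sign_kernel x - pi / 2 * sgn x\<bar> \<le> E" unfolding E_def by (rule sign_kernel_error)
  then have "E \<ge> 0" by linarith
  then have "E * 1 \<le> E * pi" using pi_gt3 by (intro mult_left_mono) auto
  then have "sign_kernel x - pi / 2 * sgn x \<le> E * pi" using E by linarith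
  then have "sign_kernel x / pi \<le> sgn x / 2 + E" by (simp add: field_simps)
  then show ?thesis using False unfolding E_def[symmetric] by (auto simp: indicator_def sgn_real_def split: if_splits)
qed

subsection \<open>Smoothing inequality in terms of the characteristic function\<close>

lemma pair_prob_space_unit_lebesgue:
  "real_distribution N \<Longrightarrow> pair_prob_space N unit_lebesgue"
  by (simp add: pair_prob_space_def pair_sigma_finite_def real_distribution_def
      prob_space_imp_sigma_finite unit_lebesgue.prob_space_axioms)

context real_distribution
begin

lemma integral_iexp_shift:
  "(CLINT x|M. iexp (s * (x + c))) = iexp (s * c) * char M s"
  unfolding char_def
  by (subst integral_mult_right_zero[symmetric])
     (simp add: exp_add[symmetric] algebra_simps)

lemma integrable_iexp_shift: "integrable M (\<lambda>x. iexp (s * (x + c)))"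
  by (rule integrable_iexp) auto

lemma integral_sin_shift: "(\<integral>x. sin (s * (x + c)) \<partial>M) = Im (iexp (s * c) * char M s)"
  using integral_Im[OF integrable_iexp_shift[of s c]]
  unfolding integral_iexp_shift[symmetric] by (simp add: Im_exp)

lemma integral_cos_shift: "(\<integral>x. cos (s * (x + c)) \<partial>M) = Re (iexp (s * c) * char M s)"
  using integral_Re[OF integrable_iexp_shift[of s c]]
  unfolding integral_iexp_shift[symmetric] by (simp add: Re_exp)

text \<open>Fubini: averaging the sine over the distribution first produces the imaginary part of
  the shifted characteristic function. The integrand is dominated by |x + c|, which the first moment
  controls.\<close>

lemma integral_sign_kernel:
  assumes "integrable M (\<lambda>x. x)"
  shows "integrable M (\<lambda>x. sign_kernel (x + c))"
    and "(\<integral>x. sign_kernel (x + c) \<partial>M)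
      = (\<integral>s. (1 - s\<^sup>2) * (Im (iexp (s * c) * char M s) / s) \<partial>unit_lebesgue)"
    and "integrable unit_lebesgue (\<lambda>s. (1 - s\<^sup>2) * (Im (iexp (s * c) * char M s) / s))"
proof -
  interpret P: pair_prob_space M unit_lebesgue
    by (rule pair_prob_space_unit_lebesgue) (rule real_distribution_axioms)
  let ?f = "\<lambda>x s. (1 - s\<^sup>2) * (sin (s * (x + c)) / s)"
  have [measurable]: "(\<lambda>x. x) \<in> borel_measurable M" by simp
  have meas: "(\<lambda>(x, s). ?f x s) \<in> borel_measurable (M \<Otimes>\<^sub>M unit_lebesgue)"
    by measurable
  have int: "integrable (M \<Otimes>\<^sub>M unit_lebesgue) (\<lambda>(x, s). ?f x s)"
  proof (rule P.Fubini_integrable[OF meas])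
    show "integrable M (\<lambda>x. \<integral>s. norm (case (x, s) of (x, s) \<Rightarrow> ?f x s) \<partial>unit_lebesgue)"
    proof (rule Bochner_Integration.integrable_bound[where f="\<lambda>x. \<bar>x + c\<bar>"])
      show "integrable M (\<lambda>x. \<bar>x + c\<bar>)" using assms by auto
      show "(\<lambda>x. \<integral>s. norm (case (x, s) of (x, s) \<Rightarrow> ?f x s) \<partial>unit_lebesgue) \<in> borel_measurable M"
        by measurable
      show "AE x in M. norm (\<integral>s. norm (case (x, s) of (x, s) \<Rightarrow> ?f x s) \<partial>unit_lebesgue) \<le> norm \<bar>x + c\<bar>"
      proof (rule AE_I2)
        fix x
        have "(\<integral>s. \<bar>?f x s\<bar> \<partial>unit_lebesgue) \<le> (\<integral>s. \<bar>x + c\<bar> \<partial>unit_lebesgue)"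
          by (rule integral_mono)
             (use abs_sign_integrand_le integrable_sign_integrand
               in \<open>auto simp del: times_divide_eq_right intro!: integrable_abs\<close>)
        then show "norm (\<integral>s. norm (case (x, s) of (x, s) \<Rightarrow> ?f x s) \<partial>unit_lebesgue) \<le> norm \<bar>x + c\<bar>"
          using unit_lebesgue.prob_space by (simp del: space_unit_lebesgue times_divide_eq_right)
      qed
    qed
    show "AE x in M. integrable unit_lebesgue (\<lambda>s. case (x, s) of (x, s) \<Rightarrow> ?f x s)"
      using integrable_sign_integrand by (auto simp del: times_divide_eq_right)
  qed
  have eq: "(\<integral>x. ?f x s \<partial>M) = (1 - s\<^sup>2) * (Im (iexp (s * c) * char M s) / s)" for s
    by (simp only: integral_mult_right_zero integral_divide_zero integral_sin_shift)
  show "integrable M (\<lambda>x. sign_kernel (x + c))"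
    using P.integrable_fst[OF int] unfolding sign_kernel_def .
  show "(\<integral>x. sign_kernel (x + c) \<partial>M)
      = (\<integral>s. (1 - s\<^sup>2) * (Im (iexp (s * c) * char M s) / s) \<partial>unit_lebesgue)"
    using P.Fubini_integral[OF int] unfolding sign_kernel_def eq ..
  show "integrable unit_lebesgue (\<lambda>s. (1 - s\<^sup>2) * (Im (iexp (s * c) * char M s) / s))"
    using P.integrable_snd[OF int] unfolding eq .
qed

lemma integrable_norm_char: "integrable unit_lebesgue (\<lambda>s. cmod (char M s))"
  by (rule unit_lebesgue.integrable_const_bound[of _ 1])
     (auto simp: cmod_char_le_1 intro!: borel_measurable_norm borel_measurable_unit_lebesgue)

text \<open>After Fubini the shift enters only through a phase of modulus 1, so the bound is the
  same for every c. This is why a large shift costs nothing in the Fejer terms.\<close>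

lemma integral_fejer_kernel_le:
  shows "integrable M (\<lambda>x. fejer_kernel (x + c))"
    and "(\<integral>x. fejer_kernel (x + c) \<partial>M) \<le> (\<integral>s. cmod (char M s) \<partial>unit_lebesgue)"
proof -
  interpret P: pair_prob_space M unit_lebesgue
    by (rule pair_prob_space_unit_lebesgue) (rule real_distribution_axioms)
  let ?f = "\<lambda>x s. (1 - s) * cos (s * (x + c))"
  have [measurable]: "(\<lambda>x. x) \<in> borel_measurable M" by simp
  have bound: "(1 - s) * \<bar>y\<bar> \<le> 1" if "0 < s" "s < 1" "\<bar>y\<bar> \<le> 1" for s y :: real
    using mult_mono[of "1 - s" 1 "\<bar>y\<bar>" 1] that by simp
  have int: "integrable (M \<Otimes>\<^sub>M unit_lebesgue) (\<lambda>(x, s). ?f x s)"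
    by (rule P.integrable_const_bound[of _ 1])
       (auto simp: space_pair_measure abs_mult intro!: AE_I2 bound)
  have eq: "(\<integral>x. ?f x s \<partial>M) = (1 - s) * Re (iexp (s * c) * char M s)" for s
    by (simp only: integral_mult_right_zero integral_cos_shift)
  show "integrable M (\<lambda>x. fejer_kernel (x + c))"
    using P.integrable_fst[OF int] unfolding fejer_kernel_def .
  have "(\<integral>x. fejer_kernel (x + c) \<partial>M) = (\<integral>s. (1 - s) * Re (iexp (s * c) * char M s) \<partial>unit_lebesgue)"
    using P.Fubini_integral[OF int] unfolding fejer_kernel_def eq ..
  also have "\<dots> \<le> (\<integral>s. cmod (char M s) \<partial>unit_lebesgue)"
  proof (rule integral_mono)
    show "integrable unit_lebesgue (\<lambda>s. (1 - s) * Re (iexp (s * c) * char M s))"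
      using P.integrable_snd[OF int] unfolding eq .
    show "integrable unit_lebesgue (\<lambda>s. cmod (char M s))" by (rule integrable_norm_char)
    fix s assume "s \<in> space unit_lebesgue"
    then have s: "0 < s" "s < 1" by auto
    have "Re (iexp (s * c) * char M s) \<le> cmod (char M s)"
      using complex_Re_le_cmod[of "iexp (s * c) * char M s"] by (simp add: norm_mult)
    then have "(1 - s) * Re (iexp (s * c) * char M s) \<le> (1 - s) * cmod (char M s)"
      using s by (intro mult_left_mono) auto
    also have "\<dots> \<le> 1 * cmod (char M s)" using s by (intro mult_right_mono) auto
    finally show "(1 - s) * Re (iexp (s * c) * char M s) \<le> cmod (char M s)" by simp
  qed
  finally show "(\<integral>x. fejer_kernel (x + c) \<partial>M) \<le> (\<integral>s. cmod (char M s) \<partial>unit_lebesgue)" .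
qed

text \<open>Integrate the majorant at x + c. The two Fejer terms, with shifts c and c + pi, obey the
  same bound, whence 80 = 2 * 40.\<close>

lemma prob_atMost_le_char:
  assumes "integrable M (\<lambda>x. x)"
  shows "measure M {..- c} \<le> 1 / 2
    - (\<integral>s. (1 - s\<^sup>2) * (Im (iexp (s * c) * char M s) / s) \<partial>unit_lebesgue) / pi
    + 80 * (\<integral>s. cmod (char M s) \<partial>unit_lebesgue)"
proof -
  have "measure M {..- c} = (\<integral>x. indicator {..0} (x + c) \<partial>M)"
  proof -
    have "(\<integral>x. indicator {..0} (x + c) \<partial>M) = (\<integral>x. indicator {..- c} x \<partial>M :: real)"
      by (intro Bochner_Integration.integral_cong) (auto simp: indicator_def)
    then show ?thesis by simp
  qed
  also have "\<dots> \<le> (\<integral>x. 1 / 2 - sign_kernel (x + c) / pi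
      + 40 * (fejer_kernel (x + c) + fejer_kernel (x + (c + pi))) \<partial>M)"
  proof (rule integral_mono)
    show "integrable M (\<lambda>x. indicator {..0} (x + c) :: real)"
      by (rule integrable_const_bound[of _ 1]) auto
    show "integrable M (\<lambda>x. 1 / 2 - sign_kernel (x + c) / pi
      + 40 * (fejer_kernel (x + c) + fejer_kernel (x + (c + pi))))"
      using integral_sign_kernel(1)[OF assms] integral_fejer_kernel_le(1) by simp
    show "indicator {..0} (x + c) \<le> 1 / 2 - sign_kernel (x + c) / pi
      + 40 * (fejer_kernel (x + c) + fejer_kernel (x + (c + pi)))" for x
      using indicator_le_kernels[of "x + c"] by (simp add: add.assoc)
  qed
  also have "\<dots> = 1 / 2 - (\<integral>x. sign_kernel (x + c) \<partial>M) / pi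
      + 40 * ((\<integral>x. fejer_kernel (x + c) \<partial>M) + (\<integral>x. fejer_kernel (x + (c + pi)) \<partial>M))"
    using integral_sign_kernel(1)[OF assms] integral_fejer_kernel_le(1) prob_space by simp
  also have "\<dots> \<le> 1 / 2 - (\<integral>x. sign_kernel (x + c) \<partial>M) / pi
      + 80 * (\<integral>s. cmod (char M s) \<partial>unit_lebesgue)"
    using integral_fejer_kernel_le(2)[of c] integral_fejer_kernel_le(2)[of "c + pi"] by simp
  finally show ?thesis unfolding integral_sign_kernel(2)[OF assms] .
qed

end

subsection \<open>Powers of a characteristic function near the origin\<close>

text \<open>Telescoping, one factor at a time. For n = 0 the truncated exponent \<open>n - 1\<close>
  is harmless because the factor n vanishes.\<close>

lemma norm_power_diff_le:
  fixes z w :: "'a::{real_normed_algebra_1, comm_monoid_mult}"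
  assumes "norm z \<le> m" "norm w \<le> m"
  shows "norm (z ^ n - w ^ n) \<le> real n * m ^ (n - 1) * norm (z - w)"
proof (induction n)
  case (Suc n)
  have m: "0 \<le> m" using assms(1) norm_ge_zero order_trans by blast
  have "z ^ Suc n - w ^ Suc n = z * (z ^ n - w ^ n) + (z - w) * w ^ n"
    by (simp add: algebra_simps)
  also have "norm \<dots> \<le> norm z * norm (z ^ n - w ^ n) + norm (z - w) * norm (w ^ n)"
    by (intro norm_triangle_mono norm_mult_ineq)
  also have "\<dots> \<le> m * (real n * m ^ (n - 1) * norm (z - w)) + norm (z - w) * m ^ n"
    using assms m Suc
    by (intro add_mono mult_mono mult_left_mono order_trans[OF norm_power_ineq] power_mono) auto
  also have "\<dots> = real (Suc n) * m ^ (Suc n - 1) * norm (z - w)"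
    by (cases n) (auto simp: algebra_simps)
  finally show ?case .
qed simp

text \<open>Trades Gaussian decay in s, with y a multiple of s^2, for a rational bound whose
  integral is an elementary arctangent.\<close>

lemma exp_minus_le_inverse:
  fixes y :: real
  assumes "y \<ge> 0"
  shows "exp (- y) \<le> 1 / (1 + y)" "y * exp (- y) \<le> 2 / (1 + y)"
proof -
  show "exp (- y) \<le> 1 / (1 + y)"
    using exp_ge_add_one_self[of y] assms by (simp add: exp_minus field_simps)
  have "y * (1 + y) \<le> 2 * (1 + y + y\<^sup>2 / 2)" using assms by (simp add: algebra_simps power2_eq_square)
  also have "\<dots> \<le> 2 * exp y" using exp_lower_Taylor_quadratic[OF assms] by simp
  finally show "y * exp (- y) \<le> 2 / (1 + y)" using assms by (simp add: exp_minus field_simps)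
qed

lemma sin_ge_cubic:
  fixes x :: real
  assumes "x \<ge> 0"
  shows "x - x ^ 3 / 6 \<le> sin x"
  using Maclaurin_sin_bound[of x 3] assms
  by (simp add: sin_coeff_def eval_nat_numeral abs_if split: if_splits)

text \<open>One frequency s is fixed: \<open>z\<close> stands for the characteristic function of a
  single step there, \<open>v\<close> for its variance and \<open>\<rho>\<close> for its third
  absolute moment. The normalisation \<open>\<rho> \<le> v\<close> keeps the cubic error below the
  quadratic term on all of (0, 1).\<close>

context
  fixes s v \<rho> :: real and z :: complex and n :: nat
  assumes s: "0 < s" "s < 1" and v: "0 < v" "v \<le> 1" and \<rho>: "\<rho> \<le> v" and n: "2 \<le> n"
    and z: "cmod (z - of_real (1 - s\<^sup>2 * v / 2)) \<le> \<rho> * s ^ 3 / 6"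
begin

private lemma s2: "0 < s\<^sup>2" "s\<^sup>2 < 1" "s ^ 3 \<le> s\<^sup>2" "s\<^sup>2 * v \<le> 1" "0 < s\<^sup>2 * v"
  using s v power_decreasing[of 2 3 s] mult_mono[of "s\<^sup>2" 1 v 1]
  by (auto simp: power_less_one_iff power_le_one)

private lemma z': "cmod (z - of_real (1 - s\<^sup>2 * v / 2)) \<le> v * s ^ 3 / 6"
proof -
  have "\<rho> * s ^ 3 \<le> v * s ^ 3" using s \<rho> by (intro mult_right_mono) auto
  then show ?thesis using z by simp
qed

text \<open>The cubic error is at most v s^2 / 6, so the modulus is at most 1 - v s^2 / 3, hence at
  most 1 - v s^2 / 4.\<close>

private lemma modulus_bounds:
  "\<bar>1 - s\<^sup>2 * v / 2\<bar> \<le> exp (- (v * s\<^sup>2 / 4))" "cmod z \<le> exp (- (v * s\<^sup>2 / 4))"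
proof -
  have e: "1 - v * s\<^sup>2 / 4 \<le> exp (- (v * s\<^sup>2 / 4))" using exp_ge_add_one_self[of "- (v * s\<^sup>2 / 4)"] by simp
  then show "\<bar>1 - s\<^sup>2 * v / 2\<bar> \<le> exp (- (v * s\<^sup>2 / 4))" using s2 by (simp add: mult.commute)
  have "cmod z \<le> \<bar>1 - s\<^sup>2 * v / 2\<bar> + cmod (z - of_real (1 - s\<^sup>2 * v / 2))"
    by (metis norm_of_real norm_triangle_sub)
  also have "\<dots> \<le> (1 - s\<^sup>2 * v / 2) + v * s\<^sup>2 / 6"
  proof -
    have "v * s ^ 3 \<le> v * s\<^sup>2" using s2(3) v by (intro mult_left_mono) auto
    then have "cmod (z - of_real (1 - s\<^sup>2 * v / 2)) \<le> v * s\<^sup>2 / 6" using z' by linarith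
    moreover have "\<bar>1 - s\<^sup>2 * v / 2\<bar> = 1 - s\<^sup>2 * v / 2" using s2 by simp
    ultimately show ?thesis by linarith
  qed
  also have "\<dots> \<le> exp (- (v * s\<^sup>2 / 4))" using e s2 by (simp add: mult.commute)
  finally show "cmod z \<le> exp (- (v * s\<^sup>2 / 4))" .
qed

private abbreviation "y \<equiv> v / 8 * real n * s\<^sup>2"

text \<open>\<open>y\<close> is half of the natural exponent n v s^2 / 4. The halving pays for the
  missing factor in the power n - 1, as n - 1 >= n / 2 for n >= 2.\<close>

private lemma exp_powers:
  "exp (- (v * s\<^sup>2 / 4)) ^ n \<le> exp (- y)" "exp (- (v * s\<^sup>2 / 4)) ^ (n - 1) \<le> exp (- y)" "0 \<le> y"
proof -
  show y: "0 \<le> y" using v by simp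
  have "v * s\<^sup>2 * real n \<le> v * s\<^sup>2 * (2 * real (n - 1))"
    using n v by (intro mult_left_mono) auto
  then show "exp (- (v * s\<^sup>2 / 4)) ^ (n - 1) \<le> exp (- y)"
    unfolding exp_of_nat_mult[symmetric] by (simp add: algebra_simps)
  show "exp (- (v * s\<^sup>2 / 4)) ^ n \<le> exp (- y)"
    using y unfolding exp_of_nat_mult[symmetric] by (simp add: algebra_simps)
qed

lemma norm_power_le: "cmod (z ^ n) \<le> 1 / (1 + v / 8 * real n * s\<^sup>2)"
proof -
  have "cmod (z ^ n) \<le> exp (- (v * s\<^sup>2 / 4)) ^ n"
    unfolding norm_power using modulus_bounds by (intro power_mono) auto
  then show ?thesis using exp_powers(1) exp_minus_le_inverse(1)[OF exp_powers(3)] by linarith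
qed

text \<open>Telescoping gives n exp(-y) times the cubic error, and n v s^2 = 8 y turns this into a
  multiple of s y exp(-y). The surviving factor s cancels the later division by s.\<close>

lemma norm_power_approx:
  "cmod (z ^ n - of_real ((1 - s\<^sup>2 * v / 2) ^ n)) \<le> 3 * s / (1 + v / 8 * real n * s\<^sup>2)"
proof -
  let ?r = "1 - s\<^sup>2 * v / 2"
  have "cmod (z ^ n - of_real (?r ^ n)) \<le> real n * exp (- (v * s\<^sup>2 / 4)) ^ (n - 1) * cmod (z - of_real ?r)"
    unfolding of_real_power using modulus_bounds
    by (intro norm_power_diff_le) (auto simp only: norm_of_real)
  also have "\<dots> \<le> real n * exp (- y) * (v * s ^ 3 / 6)"
    using z' exp_powers by (intro mult_mono) auto
  also have "\<dots> = 4 / 3 * s * (y * exp (- y))"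
    by (simp add: power2_eq_square power3_eq_cube)
  also have "\<dots> \<le> 4 / 3 * s * (2 / (1 + y))"
    using s by (intro mult_left_mono exp_minus_le_inverse(2) exp_powers(3)) auto
  also have "\<dots> \<le> 3 * s / (1 + y)"
    using s exp_powers(3) by (simp add: divide_simps)
  finally show ?thesis .
qed

text \<open>Controls the cubic term of the sine: writing s^2 = 8 y / (v n) gains a factor
  1/n.\<close>

lemma square_times_power_le:
  "s\<^sup>2 * (1 - s\<^sup>2 * v / 2) ^ n \<le> 16 / (v * real n) * (1 / (1 + v / 8 * real n * s\<^sup>2))"
proof -
  have "(1 - s\<^sup>2 * v / 2) ^ n \<le> exp (- (v * s\<^sup>2 / 4)) ^ n"
    using modulus_bounds s2 by (intro power_mono) auto
  then have "s\<^sup>2 * (1 - s\<^sup>2 * v / 2) ^ n \<le> s\<^sup>2 * exp (- y)"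
    using exp_powers(1) by (intro mult_left_mono) auto
  also have "\<dots> = 8 / (v * real n) * (y * exp (- y))" using v n by simp
  also have "\<dots> \<le> 8 / (v * real n) * (2 / (1 + y))"
    using v by (intro mult_left_mono exp_minus_le_inverse(2) exp_powers(3)) auto
  finally show ?thesis by simp
qed

text \<open>Replace the n-th power by the real number \<open>R\<close> and the sine by its cubic
  lower bound. The linear term is the gain c R; the cubic term and the replacement error become the
  two summands of the loss.\<close>

lemma Im_shifted_power_ge:
  assumes "c \<ge> 0"
  shows "c * (1 - s\<^sup>2 * v / 2) ^ n - (3 * c ^ 3 / (v * real n) + 3) * (1 / (1 + v / 8 * real n * s\<^sup>2))
    \<le> Im (iexp (s * c) * z ^ n) / s"
proof -
  define R where "R = (1 - s\<^sup>2 * v / 2) ^ n"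
  define q where "q = 1 / (1 + v / 8 * real n * s\<^sup>2)"
  have q: "0 \<le> q" using v unfolding q_def by simp
  have R: "0 \<le> R" unfolding R_def using s2 by simp
  have "Im (iexp (s * c) * z ^ n) = R * sin (s * c) + Im (iexp (s * c) * (z ^ n - of_real R))"
    by (simp add: algebra_simps Im_exp)
  moreover have "\<bar>Im (iexp (s * c) * (z ^ n - of_real R))\<bar> \<le> 3 * s * q"
    using abs_Im_le_cmod[of "iexp (s * c) * (z ^ n - of_real R)"] norm_power_approx
    unfolding R_def[symmetric] q_def by (simp add: norm_mult)
  moreover have "R * (s * c - (s * c) ^ 3 / 6) \<le> R * sin (s * c)"
    using R s assms by (intro mult_left_mono sin_ge_cubic) auto
  ultimately have "R * (s * c - (s * c) ^ 3 / 6) - 3 * s * q \<le> Im (iexp (s * c) * z ^ n)"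
    by linarith
  then have "(R * (s * c - (s * c) ^ 3 / 6) - 3 * s * q) / s \<le> Im (iexp (s * c) * z ^ n) / s"
    using s by (intro divide_right_mono) auto
  moreover have "(R * (s * c - (s * c) ^ 3 / 6) - 3 * s * q) / s = c * R - c ^ 3 / 6 * (s\<^sup>2 * R) - 3 * q"
    using s by (simp add: field_simps power2_eq_square power3_eq_cube)
  moreover have "c ^ 3 / 6 * (s\<^sup>2 * R) \<le> c ^ 3 / 6 * (16 / (v * real n) * q)"
    using square_times_power_le assms unfolding R_def q_def by (intro mult_left_mono) auto
  moreover have "c ^ 3 / 6 * (16 / (v * real n) * q) \<le> 3 * c ^ 3 / (v * real n) * q"
    using assms q v n by (simp add: divide_simps mult_right_mono)
  ultimately show ?thesis unfolding R_def[symmetric] q_def[symmetric] by (simp add: algebra_simps)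
qed

end

section \<open>Integrating the frequency bounds\<close>

lemma integral_inverse_quadratic_le:
  assumes "a > 0"
  shows "(\<integral>s. 1 / (1 + a * s\<^sup>2) \<partial>unit_lebesgue) \<le> pi / 2 / sqrt a"
    and "integrable unit_lebesgue (\<lambda>s. 1 / (1 + a * s\<^sup>2))"
proof -
  have nz: "1 + a * s\<^sup>2 > 0" for s :: real using assms by (intro add_pos_nonneg) auto
  \<comment> \<open>The arctangent is bounded by pi/2, so the integral is of order 1 / sqrt a; with
    a proportional to n this is the source of all 1 / sqrt n error terms.\<close>
  let ?F = "\<lambda>s. arctan (sqrt a * s) / sqrt a"
  have "(\<integral>s. 1 / (1 + a * s\<^sup>2) \<partial>unit_lebesgue) = ?F 1 - ?F 0"
  proof (rule integral_unit_lebesgue_FTC)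
    show "continuous_on {0..1} (\<lambda>s. 1 / (1 + a * s\<^sup>2))"
      using nz by (intro continuous_intros) (auto simp: less_imp_neq[symmetric] order_less_imp_not_eq2)
    show "(?F has_real_derivative 1 / (1 + a * s\<^sup>2)) (at s)" for s
      using assms nz[of s]
      by (auto intro!: derivative_eq_intros simp: power_mult_distrib inverse_eq_divide)
  qed
  also have "\<dots> \<le> pi / 2 / sqrt a"
    using assms divide_right_mono[OF less_imp_le[OF arctan_ubound], of "sqrt a" "sqrt a"] by simp
  finally show "(\<integral>s. 1 / (1 + a * s\<^sup>2) \<partial>unit_lebesgue) \<le> pi / 2 / sqrt a" .
  show "integrable unit_lebesgue (\<lambda>s. 1 / (1 + a * s\<^sup>2))"
    by (rule unit_lebesgue.integrable_const_bound[of _ 1])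
       (use nz assms in \<open>auto simp: divide_le_eq_1 less_imp_le abs_of_pos\<close>)
qed

lemma measure_unit_lebesgue_lessThan:
  "0 \<le> a \<Longrightarrow> a \<le> 1 \<Longrightarrow> measure unit_lebesgue ({..<a} \<inter> {0<..<1}) = a"
  "{..<a} \<inter> {0<..<1} \<in> sets unit_lebesgue"
proof -
  show "{..<a} \<inter> {0<..<1} \<in> sets unit_lebesgue"
    by (auto simp: unit_lebesgue_def sets_restrict_space)
  assume a: "0 \<le> a" "a \<le> 1"
  then have eq: "{..<a} \<inter> {0<..<1} = {0<..<a}" by auto
  have "measure (restrict_space lborel {0<..<1}) {0<..<a} = measure lborel {0<..<a}"
    using a by (intro measure_restrict_space) auto
  then show "measure unit_lebesgue ({..<a} \<inter> {0<..<1}) = a"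
    unfolding eq unit_lebesgue_def using a by simp
qed

text \<open>Gain and losses are both of order 1 / sqrt n. The gain is linear in c, while for fixed c
  the coefficient of \<open>Q\<close> inside the bracket tends to 3.\<close>

lemma (in real_distribution) prob_atMost_le_of_char_power:
  fixes \<phi> :: "real \<Rightarrow> complex"
  assumes int: "integrable M (\<lambda>x. x)"
    and char: "\<And>s. char M s = \<phi> s ^ n"
    and \<phi>: "\<And>s. 0 < s \<Longrightarrow> s < 1 \<Longrightarrow> cmod (\<phi> s - of_real (1 - s\<^sup>2 * v / 2)) \<le> \<rho> * s ^ 3 / 6"
    and v: "0 < v" "v \<le> 1" and \<rho>: "\<rho> \<le> v" and n: "4 \<le> n" and c: "0 \<le> c"
  defines "Q \<equiv> pi / 2 / sqrt (v / 8 * real n)"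
  shows "measure M {..- c} \<le> 1 / 2
    - (3 / 8 * c / sqrt (real n) - (3 * c ^ 3 / (v * real n) + 3) * Q) / pi + 80 * Q"
proof -
  define q where "q = (\<lambda>s::real. 1 / (1 + v / 8 * real n * s\<^sup>2))"
  define B where "B = 3 * c ^ 3 / (v * real n) + 3"
  \<comment> \<open>The gain is kept only for s below 1 / sqrt n, where \<open>R\<close> is still at
    least 1/2; elsewhere it is bounded below by 0.\<close>
  define I where "I = {..<1 / sqrt (real n)} \<inter> {0<..<1}"
  have a: "v / 8 * real n > 0" using v n by simp
  have q: "integrable unit_lebesgue q" "(\<integral>s. q s \<partial>unit_lebesgue) \<le> Q"
    unfolding q_def Q_def by (rule integral_inverse_quadratic_le[OF a])+
  have q0: "q s \<ge> 0" for s unfolding q_def using a v by (intro divide_nonneg_nonneg add_nonneg_nonneg mult_nonneg_nonneg) auto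
  have B0: "B \<ge> 0" unfolding B_def using c v by simp
  have I: "measure unit_lebesgue I = 1 / sqrt (real n)" "I \<in> sets unit_lebesgue"
    unfolding I_def using n by (auto intro!: measure_unit_lebesgue_lessThan)
  have "(\<integral>s. cmod (char M s) \<partial>unit_lebesgue) \<le> (\<integral>s. q s \<partial>unit_lebesgue)"
  proof (rule integral_mono[OF integrable_norm_char q(1)])
    fix s assume "s \<in> space unit_lebesgue"
    then show "cmod (char M s) \<le> q s"
      unfolding q_def char using v \<rho> n by (intro norm_power_le[OF _ _ _ _ _ _ \<phi>]) auto
  qed
  then have C: "(\<integral>s. cmod (char M s) \<partial>unit_lebesgue) \<le> Q" using q by linarith
  have "3 / 8 * c / sqrt (real n) - B * Q \<le> 3 / 8 * c / sqrt (real n) - B * (\<integral>s. q s \<partial>unit_lebesgue)"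
    using q B0 by (simp add: mult_left_mono)
  also have "\<dots> = (\<integral>s. 3 / 8 * c * indicator I s - B * q s \<partial>unit_lebesgue)"
  proof -
    have "(\<integral>s. 3 / 8 * c * indicator I s - B * q s \<partial>unit_lebesgue)
        = (\<integral>s. 3 / 8 * c * indicator I s \<partial>unit_lebesgue) - (\<integral>s. B * q s \<partial>unit_lebesgue)"
      using I q by (intro Bochner_Integration.integral_diff) (auto simp: less_top[symmetric])
    then show ?thesis using I sets.sets_into_space[OF I(2)] by (simp add: Int_absorb2)
  qed
  also have "\<dots> \<le> (\<integral>s. (1 - s\<^sup>2) * (Im (iexp (s * c) * char M s) / s) \<partial>unit_lebesgue)"
  proof (rule integral_mono)
    show "integrable unit_lebesgue (\<lambda>s. 3 / 8 * c * indicator I s - B * q s)"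
      using I q by (auto simp: less_top[symmetric])
    show "integrable unit_lebesgue (\<lambda>s. (1 - s\<^sup>2) * (Im (iexp (s * c) * char M s) / s))"
      by (rule integral_sign_kernel(3)[OF int])
    fix s assume "s \<in> space unit_lebesgue"
    then have s: "0 < s" "s < 1" by auto
    have s2: "0 < s\<^sup>2" "s\<^sup>2 < 1" using s by (auto simp: power_less_one_iff)
    define R where "R = (1 - s\<^sup>2 * v / 2) ^ n"
    have sv: "s\<^sup>2 * v \<le> 1" "s\<^sup>2 * v \<le> s\<^sup>2" using s2 v mult_mono[of "s\<^sup>2" 1 v 1] by auto
    have R: "0 \<le> R" unfolding R_def using sv by simp
    have "3 / 8 * indicator I s \<le> (1 - s\<^sup>2) * R"
    proof (cases "s \<in> I")
      case True
      then have "s\<^sup>2 \<le> (1 / sqrt (real n))\<^sup>2" unfolding I_def using s by (intro power_mono) auto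
      then have sn: "s\<^sup>2 \<le> 1 / real n" by (simp add: power_divide)
      then have "real n * s\<^sup>2 \<le> 1" using n by (simp add: field_simps)
      moreover have "real n * (s\<^sup>2 * v) \<le> real n * s\<^sup>2" using sv by (intro mult_left_mono) auto
      \<comment> \<open>Bernoulli gives R >= 1 - n s^2 v / 2 >= 1/2 on \<open>I\<close>. With 1 -
        s^2 >= 3/4, from n >= 4, this yields the factor 3/8.\<close>
      moreover have "1 + real n * (- (s\<^sup>2 * v / 2)) \<le> (1 + - (s\<^sup>2 * v / 2)) ^ n"
        using sv by (intro Bernoulli_inequality) auto
      ultimately have "1 / 2 \<le> R" unfolding R_def by simp
      moreover have "1 / real n \<le> 1 / 4" using n by (intro divide_left_mono) auto
      ultimately have "3 / 4 * (1 / 2) \<le> (1 - s\<^sup>2) * R" using sn s2 by (intro mult_mono) auto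
      then show ?thesis using True by simp
    qed (use R s2 in simp)
    then have "c * (3 / 8 * indicator I s) \<le> c * ((1 - s\<^sup>2) * R)"
      using c by (intro mult_left_mono)
    moreover have "(1 - s\<^sup>2) * (B * q s) \<le> B * q s"
      using B0 q0 s2 by (intro mult_left_le_one_le) auto
    moreover have "(1 - s\<^sup>2) * (c * R - B * q s) \<le> (1 - s\<^sup>2) * (Im (iexp (s * c) * char M s) / s)"
      unfolding B_def q_def R_def char
      using s s2 v \<rho> n c by (intro mult_left_mono Im_shifted_power_ge[OF _ _ _ _ _ _ \<phi>]) auto
    moreover have "(1 - s\<^sup>2) * (c * R - B * q s) = c * ((1 - s\<^sup>2) * R) - (1 - s\<^sup>2) * (B * q s)"
      by (simp add: algebra_simps)
    ultimately show "3 / 8 * c * indicator I s - B * q s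
        \<le> (1 - s\<^sup>2) * (Im (iexp (s * c) * char M s) / s)"
      by linarith
  qed
  finally have "(3 / 8 * c / sqrt (real n) - B * Q) / pi
      \<le> (\<integral>s. (1 - s\<^sup>2) * (Im (iexp (s * c) * char M s) / s) \<partial>unit_lebesgue) / pi"
    by (intro divide_right_mono) auto
  then show ?thesis using prob_atMost_le_char[OF int, of c] C unfolding B_def by linarith
qed

subsection \<open>Centred random walks and medians\<close>

lemma (in prob_space) integrable_lower_power:
  fixes X :: "'a \<Rightarrow> real"
  assumes [measurable]: "random_variable borel X"
    and "integrable M (\<lambda>x. \<bar>X x\<bar> ^ n)" and "k \<le> n"
  shows "integrable M (\<lambda>x. X x ^ k)"
proof (rule Bochner_Integration.integrable_bound[where f="\<lambda>x. 1 + \<bar>X x\<bar> ^ n"])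
  show "integrable M (\<lambda>x. 1 + \<bar>X x\<bar> ^ n)" using assms by simp
  have "\<bar>t\<bar> ^ k \<le> 1 + \<bar>t\<bar> ^ n" for t :: real
  proof (cases "\<bar>t\<bar> \<le> 1")
    case True
    then show ?thesis using power_le_one[of "\<bar>t\<bar>" k] zero_le_power[of "\<bar>t\<bar>" n] by linarith
  next
    case False
    then show ?thesis using power_increasing[OF \<open>k \<le> n\<close>, of "\<bar>t\<bar>"] by linarith
  qed
  then show "AE x in M. norm (X x ^ k) \<le> norm (1 + \<bar>X x\<bar> ^ n)"
    by (auto simp: power_abs)
qed simp

lemma (in prob_space) sum_atMost_lt_half_normalised:
  fixes X :: "nat \<Rightarrow> 'a \<Rightarrow> real"
  assumes indep: "indep_vars (\<lambda>_. borel) X UNIV"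
    and ident: "\<And>k. distr M borel (X k) = distr M borel (X 0)"
    and third: "integrable M (\<lambda>x. \<bar>X 0 x\<bar> ^ 3)"
    and mean: "expectation (X 0) = 0"
    and v: "0 < expectation (\<lambda>x. (X 0 x)\<^sup>2)" "expectation (\<lambda>x. (X 0 x)\<^sup>2) \<le> 1"
    and \<rho>: "expectation (\<lambda>x. \<bar>X 0 x\<bar> ^ 3) \<le> expectation (\<lambda>x. (X 0 x)\<^sup>2)"
  shows "\<exists>c. \<forall>\<^sub>F n in sequentially. prob {x \<in> space M. (\<Sum>k<n. X k x) \<le> - c} < 1 / 2"
proof -
  define v where "v = expectation (\<lambda>x. (X 0 x)\<^sup>2)"
  define \<rho> where "\<rho> = expectation (\<lambda>x. \<bar>X 0 x\<bar> ^ 3)"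
  define \<phi> where "\<phi> = char (distr M borel (X 0))"
  have rv [measurable]: "random_variable borel (X k)" for k
    using indep unfolding indep_vars_def2 by simp
  have X2: "integrable M (\<lambda>x. (X 0 x)\<^sup>2)" and X1: "integrable M (X 0)"
    using integrable_lower_power[OF rv third, of 2] integrable_lower_power[OF rv third, of 1] by simp_all
  have "integrable (distr M borel (X k)) (\<lambda>x. x) \<longleftrightarrow> integrable M (X k)" for k
    by (rule integrable_distr_eq) simp_all
  then have int: "integrable M (X k)" for k using X1 ident by metis
  have \<phi>: "cmod (\<phi> s - of_real (1 - s\<^sup>2 * v / 2)) \<le> \<rho> * s ^ 3 / 6" if "0 < s" for s
  proof -
    have "variance (X 0) = v" by (simp add: mean v_def)
    then have "cmod (\<phi> s - (1 - s\<^sup>2 * v / 2))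
        \<le> s\<^sup>2 / 6 * expectation (\<lambda>x. min (6 * (X 0 x)\<^sup>2) (\<bar>s\<bar> * \<bar>X 0 x\<bar> ^ 3))"
      unfolding \<phi>_def by (intro char_approx3'[OF rv X1 X2 mean _ refl])
    \<comment> \<open>Of the two bounds inside the minimum only the cubic one is kept.\<close>
    also have "\<dots> \<le> s\<^sup>2 / 6 * expectation (\<lambda>x. \<bar>s\<bar> * \<bar>X 0 x\<bar> ^ 3)"
      using third X2 by (intro mult_left_mono integral_mono integrable_min) auto
    also have "\<dots> = \<rho> * s ^ 3 / 6"
      using that by (simp add: \<rho>_def power2_eq_square power3_eq_cube)
    finally show ?thesis by simp
  qed
  \<comment> \<open>This is the integral bound with 1 / sqrt n factored out.\<close>
  define q where "q = pi / 2 / sqrt (v / 8)"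
  \<comment> \<open>Once n is so large that 3 c^3 / (v n) <= 1, the losses are at most 4 q + 80 pi q
    after multiplying by pi sqrt n. This c makes 3/8 c exceed them by 1, and it does not depend on
    n.\<close>
  define c where "c = 8 / 3 * ((4 + 80 * pi) * q + 1)"
  have v0: "0 < v" "v \<le> 1" "\<rho> \<le> v" using v \<rho> by (simp_all add: v_def \<rho>_def)
  have q0: "0 < q" unfolding q_def using v0 by simp
  have c0: "0 \<le> c" unfolding c_def using q0 by (intro mult_nonneg_nonneg add_nonneg_nonneg) auto
  have main: "prob {x \<in> space M. (\<Sum>k<n. X k x) \<le> - c} < 1 / 2"
    if n: "n \<ge> 4" "real n \<ge> 3 * c ^ 3 / v" for n
  proof -
    let ?S = "\<lambda>x. \<Sum>k<n. X k x"
    let ?N = "distr M borel ?S"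
    interpret N: real_distribution ?N by (rule real_distribution_distr) simp
    have "prob {x \<in> space M. ?S x \<le> - c} = measure ?N {..- c}"
      by (subst measure_distr) (auto intro!: arg_cong[where f=prob])
    also have "\<dots> \<le> 1 / 2 - (3 / 8 * c / sqrt (real n)
        - (3 * c ^ 3 / (v * real n) + 3) * (pi / 2 / sqrt (v / 8 * real n))) / pi
        + 80 * (pi / 2 / sqrt (v / 8 * real n))"
    proof (rule N.prob_atMost_le_of_char_power)
      show "integrable ?N (\<lambda>x. x)" using int by (subst integrable_distr_eq) auto
      show "char ?N s = \<phi> s ^ n" for s
      proof -
        have "char ?N s = (\<Prod>k<n. char (distr M borel (X k)) s)"
          by (intro char_distr_sum indep_vars_subset[OF indep]) auto
        also have "\<dots> = (\<Prod>k<n. \<phi> s)"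
          unfolding \<phi>_def by (intro prod.cong refl) (metis ident)
        finally show ?thesis by simp
      qed
      show "cmod (\<phi> s - of_real (1 - s\<^sup>2 * v / 2)) \<le> \<rho> * s ^ 3 / 6" if "0 < s" for s
        by (rule \<phi>[OF that])
    qed (use v0 n c0 in simp_all)
    also have "pi / 2 / sqrt (v / 8 * real n) = q / sqrt (real n)"
      by (simp only: q_def real_sqrt_mult divide_divide_eq_left)
    also have "1 / 2 - (3 / 8 * c / sqrt (real n) - (3 * c ^ 3 / (v * real n) + 3) * (q / sqrt (real n))) / pi
        + 80 * (q / sqrt (real n))
        = 1 / 2 - (3 / 8 * c - (3 * c ^ 3 / (v * real n) + 3) * q - 80 * pi * q) / (pi * sqrt (real n))"
      using n by (simp add: field_simps)
    also have "\<dots> < 1 / 2"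
    proof -
      have "3 * c ^ 3 / (v * real n) \<le> 1" using n v0 by (simp add: field_simps)
      then have "(3 * c ^ 3 / (v * real n) + 3) * q \<le> 4 * q" using q0 by (intro mult_right_mono) auto
      moreover have "3 / 8 * c = 4 * q + 80 * pi * q + 1" by (simp add: c_def algebra_simps)
      ultimately have "0 < 3 / 8 * c - (3 * c ^ 3 / (v * real n) + 3) * q - 80 * pi * q"
        by linarith
      then show ?thesis using n by simp
    qed
    finally show ?thesis .
  qed
  have "\<forall>\<^sub>F n in sequentially. n \<ge> 4 \<and> real n \<ge> 3 * c ^ 3 / v"
    using filterlim_real_sequentially
    by (intro eventually_conj eventually_ge_at_top) (auto simp: filterlim_at_top)
  then have "\<forall>\<^sub>F n in sequentially. prob {x \<in> space M. (\<Sum>k<n. X k x) \<le> - c} < 1 / 2"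
    by (rule eventually_mono) (use main in blast)
  then show ?thesis by blast
qed

text \<open>Scaling the steps by d multiplies the second moment by d^2 and the third by d^3, hence
  their ratio by d. A small d therefore reaches the normalised case, and the threshold becomes c /
  d.\<close>

lemma (in prob_space) sum_atMost_lt_half:
  fixes X :: "nat \<Rightarrow> 'a \<Rightarrow> real"
  assumes indep: "indep_vars (\<lambda>_. borel) X UNIV"
    and ident: "\<And>k. distr M borel (X k) = distr M borel (X 0)"
    and third: "integrable M (\<lambda>x. \<bar>X 0 x\<bar> ^ 3)"
    and mean: "expectation (X 0) = 0"
    and v: "0 < expectation (\<lambda>x. (X 0 x)\<^sup>2)"
  shows "\<exists>c. \<forall>\<^sub>F n in sequentially. prob {x \<in> space M. (\<Sum>k<n. X k x) \<le> - c} < 1 / 2"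
proof -
  define v where "v = expectation (\<lambda>x. (X 0 x)\<^sup>2)"
  define \<rho> where "\<rho> = expectation (\<lambda>x. \<bar>X 0 x\<bar> ^ 3)"
  \<comment> \<open>Each summand of the denominator secures one requirement: d <= 1, d v <= 1 and d
    \<open>\<rho>\<close> <= v.\<close>
  define d where "d = 1 / (1 + v + \<rho> / v)"
  have rv [measurable]: "random_variable borel (X k)" for k
    using indep unfolding indep_vars_def2 by simp
  have v0: "0 < v" using v by (simp add: v_def)
  have \<rho>0: "0 \<le> \<rho>" unfolding \<rho>_def by simp
  have d: "0 < d" "d * v \<le> 1" "d \<le> 1" "d * \<rho> \<le> v"
  proof -
    have D: "1 + v + \<rho> / v \<ge> 1" "1 + v + \<rho> / v \<ge> v" "1 + v + \<rho> / v \<ge> \<rho> / v" using v0 \<rho>0 by auto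
    then show "0 < d" "d * v \<le> 1" "d \<le> 1" unfolding d_def by (auto simp: divide_le_eq)
    have "\<rho> \<le> v * (1 + v + \<rho> / v)" using mult_left_mono[OF D(3), of v] v0 by simp
    then show "d * \<rho> \<le> v" unfolding d_def using D by (simp add: divide_le_eq)
  qed
  have "\<exists>c. \<forall>\<^sub>F n in sequentially. prob {x \<in> space M. (\<Sum>k<n. d * X k x) \<le> - c} < 1 / 2"
  proof (rule sum_atMost_lt_half_normalised)
    show "indep_vars (\<lambda>_. borel) (\<lambda>k x. d * X k x) UNIV"
      by (rule indep_vars_compose2[OF indep]) simp
    show "distr M borel (\<lambda>x. d * X k x) = distr M borel (\<lambda>x. d * X 0 x)" for k
      using distr_distr[of "\<lambda>x. d * x" borel borel "X k" M] distr_distr[of "\<lambda>x. d * x" borel borel "X 0" M] ident[of k]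
      by (simp add: comp_def)
    show "integrable M (\<lambda>x. \<bar>d * X 0 x\<bar> ^ 3)"
      using third by (simp add: abs_mult power_mult_distrib)
    show "expectation (\<lambda>x. d * X 0 x) = 0" using mean by simp
    have 2: "expectation (\<lambda>x. (d * X 0 x)\<^sup>2) = d\<^sup>2 * v" by (simp add: power_mult_distrib v_def)
    have 3: "expectation (\<lambda>x. \<bar>d * X 0 x\<bar> ^ 3) = d ^ 3 * \<rho>"
      using d by (simp add: power_mult_distrib abs_mult \<rho>_def)
    show "0 < expectation (\<lambda>x. (d * X 0 x)\<^sup>2)" unfolding 2 using d v0 by simp
    show "expectation (\<lambda>x. (d * X 0 x)\<^sup>2) \<le> 1" unfolding 2
      using mult_mono[of d 1 "d * v" 1] d v0 by (simp add: power2_eq_square mult.assoc)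
    show "expectation (\<lambda>x. \<bar>d * X 0 x\<bar> ^ 3) \<le> expectation (\<lambda>x. (d * X 0 x)\<^sup>2)" unfolding 2 3
      using mult_left_mono[OF d(4), of "d\<^sup>2"] by (simp add: power2_eq_square power3_eq_cube mult.assoc)
  qed
  then obtain c where c: "\<forall>\<^sub>F n in sequentially. prob {x \<in> space M. (\<Sum>k<n. d * X k x) \<le> - c} < 1 / 2"
    by blast
  have "(\<Sum>k<n. d * X k x) \<le> - c \<longleftrightarrow> (\<Sum>k<n. X k x) \<le> - (c / d)" for n x
    unfolding sum_distrib_left[symmetric] using d by (simp add: field_simps)
  then show ?thesis using c by auto
qed

section \<open>Medians and non-degeneracy\<close>

lemma (in prob_space) median_rv_ge:
  assumes [measurable]: "random_variable borel Y" and "prob {x \<in> space M. Y x \<le> m} < 1 / 2"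
  shows "m \<le> median_rv M Y"
proof -
  interpret D: real_distribution "distr M borel Y" by (rule real_distribution_distr) simp
  have cdf: "cdf (distr M borel Y) t = prob {x \<in> space M. Y x \<le> t}" for t
    unfolding cdf_def by (subst measure_distr) (auto intro!: arg_cong[where f=prob])
  \<comment> \<open>The set defining the median must be shown nonempty before its infimum can be
    bounded below.\<close>
  have "\<forall>\<^sub>F t in at_top. 1 / 2 < cdf (distr M borel Y) t"
    by (rule order_tendstoD[OF D.cdf_lim_at_top_prob]) simp
  then obtain t where "1 / 2 < cdf (distr M borel Y) t"
    by (auto dest: eventually_happens)
  then have "{t. 1 / 2 \<le> prob {x \<in> space M. Y x \<le> t}} \<noteq> {}"
    unfolding cdf by (auto intro!: exI[of _ t])
  then show ?thesis
    unfolding median_rv_def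
  proof (rule cInf_greatest)
    fix t assume "t \<in> {t. 1 / 2 \<le> prob {x \<in> space M. Y x \<le> t}}"
    then have "\<not> prob {x \<in> space M. Y x \<le> t} \<le> prob {x \<in> space M. Y x \<le> m}" using assms by simp
    then have "\<not> t \<le> m" by (auto intro!: finite_measure_mono)
    then show "m \<le> t" by simp
  qed
qed

text \<open>Positivity of \<open>Y\<close> bounds the defining set below by 0, so that its infimum
  lies below each of its members.\<close>

lemma (in prob_space) median_rv_le:
  assumes [measurable]: "random_variable borel Y" and pos: "\<And>x. x \<in> space M \<Longrightarrow> 0 < Y x"
    and "1 / 2 \<le> prob {x \<in> space M. Y x \<le> m}"
  shows "median_rv M Y \<le> m"
  unfolding median_rv_def
proof (rule cInf_lower)
  show "m \<in> {t. 1 / 2 \<le> prob {x \<in> space M. Y x \<le> t}}" using assms by simp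
  have "0 \<le> t" if "1 / 2 \<le> prob {x \<in> space M. Y x \<le> t}" for t
  proof (rule ccontr)
    assume "\<not> 0 \<le> t"
    then have "{x \<in> space M. Y x \<le> t} = {}" using pos by force
    then have "prob {x \<in> space M. Y x \<le> t} = 0" by (simp only: measure_empty)
    then show False using that by simp
  qed
  then show "bdd_below {t. 1 / 2 \<le> prob {x \<in> space M. Y x \<le> t}}" by (intro bdd_belowI[of _ 0]) auto
qed

text \<open>If the second moment about m vanished, \<open>Y\<close> would equal m almost surely, and
  a point mass at m lies in the lattice m + Z.\<close>

lemma (in prob_space) variance_pos_if_not_lattice:
  assumes [measurable]: "random_variable borel Y" and "integrable M (\<lambda>x. (Y x - m)\<^sup>2)"
    and "\<not> lattice_rv M Y"
  shows "0 < expectation (\<lambda>x. (Y x - m)\<^sup>2)"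
proof (rule ccontr)
  assume "\<not> 0 < expectation (\<lambda>x. (Y x - m)\<^sup>2)"
  moreover have "0 \<le> expectation (\<lambda>x. (Y x - m)\<^sup>2)" by simp
  ultimately have "expectation (\<lambda>x. (Y x - m)\<^sup>2) = 0" by linarith
  then have "AE x in M. (Y x - m)\<^sup>2 = 0"
    using assms(2) by (subst (asm) integral_nonneg_eq_0_iff_AE) auto
  then have "AE x in M. \<exists>z::int. Y x = m + 1 * of_int z"
    by eventually_elim (auto intro!: exI[of _ 0])
  moreover have "{x \<in> space M. \<exists>z::int. Y x = m + 1 * of_int z} \<in> events"
    by measurable
  ultimately have "prob {x \<in> space M. \<exists>z::int. Y x = m + 1 * of_int z} = 1"
    by (simp only: prob_Collect_eq_1)
  then have "lattice_rv M Y"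
    unfolding lattice_rv_def by (intro exI[of _ m] exI[of _ 1] conjI zero_less_one)
  then show False using assms(3) by blast
qed

theorem theorem4:
  fixes M :: "'a measure" and a :: "nat \<Rightarrow> 'a \<Rightarrow> real"
  assumes "prob_space M"
    and meas: "\<And>k. a k \<in> borel_measurable M"
    and indep: "prob_space.indep_vars M (\<lambda>_. borel) a UNIV"
    and ident: "\<And>k. distr M borel (a k) = distr M borel (a 0)"
    and pos: "\<And>k x. x \<in> space M \<Longrightarrow> a k x > 0"
    and nonlattice: "\<not> lattice_rv M (\<lambda>x. ln (a 0 x))"
    and third: "integrable M (\<lambda>x. \<bar>ln (a 0 x)\<bar> ^ 3)"
  shows "((\<lambda>K. median_rv M (\<lambda>x. \<Prod>k<K. a k x)) \<longlonglongrightarrow> 0)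
           \<longleftrightarrow> prob_space.expectation M (\<lambda>x. ln (a 0 x)) < 0"
proof -
  interpret prob_space M by fact
  note meas [measurable]
  define \<mu> where "\<mu> = expectation (\<lambda>x. ln (a 0 x))"
  let ?P = "\<lambda>K x. \<Prod>k<K. a k x"
  let ?S = "\<lambda>K x. \<Sum>k<K. ln (a k x)"
  have int: "integrable M (\<lambda>x. ln (a 0 x) ^ k)" if "k \<le> 3" for k
    using integrable_lower_power[OF _ third that] by simp
  have int1: "integrable M (\<lambda>x. ln (a 0 x))" using int[of 1] by simp
  have int2: "integrable M (\<lambda>x. (ln (a 0 x) - \<mu>)\<^sup>2)"
    using int1 int[of 2] by (simp add: power2_diff)
  have var: "0 < expectation (\<lambda>x. (ln (a 0 x) - \<mu>)\<^sup>2)"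
    using int2 nonlattice by (intro variance_pos_if_not_lattice) auto
  have cubic: "\<bar>t - \<mu>\<bar> ^ 3 \<le> 8 * (\<bar>t\<bar> ^ 3 + \<bar>\<mu>\<bar> ^ 3)" for t :: real
  proof -
    have "\<bar>t - \<mu>\<bar> ^ 3 \<le> (2 * max \<bar>t\<bar> \<bar>\<mu>\<bar>) ^ 3" by (intro power_mono) auto
    also have "\<dots> \<le> 8 * (\<bar>t\<bar> ^ 3 + \<bar>\<mu>\<bar> ^ 3)" by (simp add: power_mult_distrib max_def)
    finally show ?thesis .
  qed
  have "integrable M (\<lambda>x. \<bar>ln (a 0 x) - \<mu>\<bar> ^ 3)"
    by (rule Bochner_Integration.integrable_bound[where f="\<lambda>x. 8 * (\<bar>ln (a 0 x)\<bar> ^ 3 + \<bar>\<mu>\<bar> ^ 3)"])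
       (use third cubic in \<open>auto simp: abs_of_nonneg\<close>)
  \<comment> \<open>The sign e serves both tails: e = 1 bounds the lower tail of the centred sum, e
    = -1 the upper one.\<close>
  then have *: "\<exists>c. \<forall>\<^sub>F n in sequentially. prob {x \<in> space M. (\<Sum>k<n. e * (ln (a k x) - \<mu>)) \<le> - c} < 1 / 2"
    if e: "e = 1 \<or> e = - 1" for e
  proof (intro sum_atMost_lt_half)
    show "indep_vars (\<lambda>_. borel) (\<lambda>k x. e * (ln (a k x) - \<mu>)) UNIV"
      by (rule indep_vars_compose2[OF indep]) simp
    show "distr M borel (\<lambda>x. e * (ln (a k x) - \<mu>)) = distr M borel (\<lambda>x. e * (ln (a 0 x) - \<mu>))" for k
      using distr_distr[of "\<lambda>x. e * (ln x - \<mu>)" borel borel "a k" M]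
        distr_distr[of "\<lambda>x. e * (ln x - \<mu>)" borel borel "a 0" M] ident[of k]
      by (simp add: comp_def)
  qed (use e int1 var prob_space \<mu>_def in \<open>auto simp: power2_commute abs_minus_commute\<close>)
  have S_eq: "?P K x = exp (?S K x)" if "x \<in> space M" for K x
    using pos[OF that] by (simp add: exp_sum)
  have P_pos: "0 < ?P K x" if "x \<in> space M" for K x
    using pos[OF that] by (simp add: prod_pos)
  have P_le: "{x \<in> space M. ?P K x \<le> exp t} = {x \<in> space M. ?S K x \<le> t}" for K t
    using S_eq by auto
  show ?thesis
  proof
    assume lim: "(\<lambda>K. median_rv M (?P K)) \<longlonglongrightarrow> 0"
    show "expectation (\<lambda>x. ln (a 0 x)) < 0"
    proof (rule ccontr)
      assume "\<not> expectation (\<lambda>x. ln (a 0 x)) < 0"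
      then have \<mu>: "0 \<le> \<mu>" by (simp add: \<mu>_def)
      obtain c where c: "\<forall>\<^sub>F n in sequentially. prob {x \<in> space M. (\<Sum>k<n. 1 * (ln (a k x) - \<mu>)) \<le> - c} < 1 / 2"
        using *[of 1] by blast
      have "\<forall>\<^sub>F n in sequentially. exp (- c) \<le> median_rv M (?P n)"
        using c
      proof eventually_elim
        case (elim n)
        \<comment> \<open>Since n \<open>\<mu>\<close> >= 0, the centred sum lies below the sum of
          logarithms, so the event only grows. A fixed positive lower bound for the medians then
          contradicts the limit 0.\<close>
        have "prob {x \<in> space M. ?P n x \<le> exp (- c)} \<le> prob {x \<in> space M. (\<Sum>k<n. 1 * (ln (a k x) - \<mu>)) \<le> - c}"
          unfolding P_le using mult_nonneg_nonneg[OF of_nat_0_le_iff[of n] \<mu>]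
          by (intro finite_measure_mono) (auto simp: sum_subtractf)
        then show ?case using elim by (intro median_rv_ge) auto
      qed
      then have "exp (- c) \<le> 0" using lim by (intro tendsto_lowerbound[OF lim]) auto
      then show False by simp
    qed
  next
    assume "expectation (\<lambda>x. ln (a 0 x)) < 0"
    then have \<mu>: "\<mu> < 0" by (simp add: \<mu>_def)
    obtain c where c: "\<forall>\<^sub>F n in sequentially. prob {x \<in> space M. (\<Sum>k<n. - 1 * (ln (a k x) - \<mu>)) \<le> - c} < 1 / 2"
      using *[of "- 1"] by blast
    have upper: "\<forall>\<^sub>F n in sequentially. median_rv M (?P n) \<le> exp (c + real n * \<mu>)"
      using c
    proof eventually_elim
      case (elim n)
      \<comment> \<open>Outside this event the sum of logarithms is less than c + n
        \<open>\<mu>\<close>, and the complement has probability above 1/2.\<close>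
      let ?A = "{x \<in> space M. (\<Sum>k<n. - 1 * (ln (a k x) - \<mu>)) \<le> - c}"
      have "1 / 2 < prob (space M - ?A)" using elim by (subst prob_compl) auto
      also have "\<dots> \<le> prob {x \<in> space M. ?P n x \<le> exp (c + real n * \<mu>)}"
        unfolding P_le by (intro finite_measure_mono) (auto simp: sum_subtractf sum_negf)
      finally show ?case using P_pos by (intro median_rv_le) auto
    qed
    have lower: "0 \<le> median_rv M (?P n)" for n
    proof (rule median_rv_ge)
      have "{x \<in> space M. ?P n x \<le> 0} = {}" using P_pos[of _ n] by (auto simp: not_le)
      then have "prob {x \<in> space M. ?P n x \<le> 0} = 0" by (simp only: measure_empty)
      then show "prob {x \<in> space M. ?P n x \<le> 0} < 1 / 2" by simp
    qed simp
    have "filterlim (\<lambda>n. c + real n * \<mu>) at_bot sequentially"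
      using \<mu> by real_asymp
    then have "(\<lambda>n. exp (c + real n * \<mu>)) \<longlonglongrightarrow> 0"
      by (rule filterlim_compose[OF exp_at_bot])
    then show "(\<lambda>K. median_rv M (?P K)) \<longlonglongrightarrow> 0"
      by (intro tendsto_sandwich[OF _ upper tendsto_const]) (auto simp: lower)
  qed
qed

end
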